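(* The real line $\mathbb{R}$, the space of rational numbers $\mathbb{Q}$ and the space of irrational numbers $P=\mathbb{R}\setminus\mathbb{Q}$ (all with the usual subspace topology from $\mathbb{R}$) are each reconstructible.
   Context: For a topological space $X$ and $x \in X$, the set $X\setminus\{x\}$ carries the subspace topology. A card of $X$ is a space homeomorphic to $X \setminus \{x\}$ for some $x \in X$. The deck of $X$ is $\mathcal{D}(X)=\{[X\setminus\{x\}]_\sim : x \in X\}$, where $[Y]_\sim$ denotes the homeomorphism class of $Y$. A space $Z$ is a reconstruction of $X$ if $\mathcal{D}(Z)=\mathcal{D}(X)$. A space $X$ is reconstructible if every reconstruction of $X$ is homeomorphic to $X$. *)

theory Defs
  imports "HOL-Analysis.Analysis"
begin

definition card_at :: "'a topology \<Rightarrow> 'a \<Rightarrow> 'a topology" where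
  "card_at X x = subtopology X (topspace X - {x})"

text \<open>Z is a reconstruction of X: the decks (sets of homeomorphism classes of cards)
  coincide, i.e. every card of Z is homeomorphic to some card of X and vice versa.
  Z and X may live on different carrier types.\<close>
definition is_reconstruction :: "'b topology \<Rightarrow> 'a topology \<Rightarrow> bool" where
  "is_reconstruction Z X \<longleftrightarrow>
     (\<forall>z\<in>topspace Z. \<exists>x\<in>topspace X. card_at Z z homeomorphic_space card_at X x) \<and>
     (\<forall>x\<in>topspace X. \<exists>z\<in>topspace Z. card_at X x homeomorphic_space card_at Z z)"

end

theory Submission
  imports Defs
begin

text \<open>Two distinct cards show that points of a reconstruction \<open>Z\<close> are closed, so cards are open
  subspaces and \<open>Z\<close> is Hausdorff.

  For \<open>\<rat>\<close> and its complement, write \<open>S\<close> for the space. All nonempty open subsets of \<open>S\<close> are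
  homeomorphic to one another: such a set is a disjoint union of infinitely many traces of dyadic
  intervals, and all these traces are homeomorphic. Zero-dimensionality splits \<open>Z\<close> into two nonempty
  clopen parts; each of them misses a point, hence sits in a card as an open set and is homeomorphic
  to an open subset of \<open>S\<close>. So \<open>Z\<close> is homeomorphic to the sum of two open half-lines of \<open>S\<close>,
  which is \<open>S\<close>.

  For \<open>\<real>\<close>, deleting \<open>z\<close> leaves two open lines \<open>L\<close> and \<open>M\<close>. Neither is closed, as otherwise the card
  at a point of \<open>L\<close> would fall into three open pieces. Hence \<open>L \<union> {z}\<close> is closed and connected; seen in
  the card at a point of \<open>M\<close> it is a closed ray ending at \<open>z\<close>. The same holds for \<open>M \<union> {z}\<close>, and the
  two rays are glued at \<open>z\<close>.\<close>

lemma isCont_frac: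
  fixes x :: real
  assumes "x \<notin> \<int>"
  shows "isCont frac x"
  unfolding frac_def isCont_def
  by (intro tendsto_intros tendsto_of_int_floor) (use assms in auto)

subsection \<open>Open subsets of the rationals and of the irrationals\<close>

text \<open>The points \<open>c + k / 2 ^ n\<close> all avoid \<open>S\<close>, so dyadic intervals based at \<open>c\<close> have clopen trace
  on \<open>S\<close>.\<close>

locale dyadic_grid_gap =
  fixes S :: "real set" and c :: real
  assumes nonempty: "S \<noteq> {}"
    and add_int: "x \<in> S \<Longrightarrow> x + of_int k \<in> S"
    and double_iff: "2 * x \<in> S \<longleftrightarrow> x \<in> S"
    and gap: "x \<in> S \<Longrightarrow> 2 ^ n * (x - c) \<notin> \<int>"
begin

lemma power2_iff: "2 ^ n * x \<in> S \<longleftrightarrow> x \<in> S"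
proof (induction n)
  case (Suc n)
  then show ?case using double_iff[of "2 ^ n * x"] by (simp add: mult.assoc)
qed simp

section \<open>Dyadic cells and the level of a point in an open set\<close>

definition idx :: "nat \<Rightarrow> real \<Rightarrow> int" where
  "idx n x = \<lfloor>2 ^ n * (x - c)\<rfloor>"

text \<open>Closed intervals, so that cells are compact; the endpoints are grid points outside
  \<open>S\<close>, so the trace on \<open>S\<close> is also that of the open interval.\<close>

definition cell :: "nat \<Rightarrow> int \<Rightarrow> real set" where
  "cell n k = {c + of_int k / 2 ^ n .. c + (of_int k + 1) / 2 ^ n}"

lemma mem_cell_idx: "x \<in> cell n (idx n x)"
proof -
  have "of_int (idx n x) \<le> 2 ^ n * (x - c)" "2 ^ n * (x - c) \<le> of_int (idx n x) + 1"
    unfolding idx_def by linarith+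
  then have "of_int (idx n x) / 2 ^ n \<le> x - c" "x - c \<le> (of_int (idx n x) + 1) / 2 ^ n"
    by (simp_all add: field_simps)
  then show ?thesis unfolding cell_def by simp
qed

text \<open>The grids are nested: the floor of a quotient by a positive integer depends only on the
  floor of the numerator.\<close>

lemma idx_coarsen: "idx m x = idx (m + d) x div 2 ^ d"
proof -
  have "2 ^ (m + d) * (x - c) / of_int (2 ^ d) = 2 ^ m * (x - c)"
    by (simp add: power_add)
  then show ?thesis
    unfolding idx_def using floor_divide_real_eq_div[of "2 ^ d" "2 ^ (m + d) * (x - c)"] by simp
qed

lemma idx_eq_coarser:
  assumes "idx n x = idx n y" "m \<le> n"
  shows "idx m x = idx m y"
  using idx_coarsen[of m _ "n - m"] assms by simp

lemma cell_diam: "x \<in> cell n k \<Longrightarrow> y \<in> cell n k \<Longrightarrow> dist x y \<le> 1 / 2 ^ n"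
  unfolding cell_def dist_real_def by (auto simp: add_divide_distrib)

lemma small_cell:
  assumes "open U" "x \<in> U"
  shows "\<exists>n. cell n (idx n x) \<subseteq> U"
proof -
  obtain e where e: "e > 0" "ball x e \<subseteq> U" using assms open_contains_ball by metis
  obtain n where n: "(1/2) ^ n < e" using real_arch_pow_inv[OF e(1), where x = "1/2"] by auto
  have "y \<in> U" if "y \<in> cell n (idx n x)" for y
    using cell_diam[OF mem_cell_idx that] n e by (auto simp: power_one_over)
  then show ?thesis by blast
qed

text \<open>Selects the largest cell around \<open>x\<close> that fits into \<open>U\<close>, as in
  a Whitney decomposition. Meaningful only for \<open>x\<close> in an open \<open>U\<close>, where
  \<open>small_cell\<close> supplies a candidate.\<close>

definition level :: "real set \<Rightarrow> real \<Rightarrow> nat" where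
  "level U x = (LEAST n. cell n (idx n x) \<subseteq> U)"

lemma level_cell:
  assumes "open U" "x \<in> U"
  shows "cell (level U x) (idx (level U x) x) \<subseteq> U"
  unfolding level_def using small_cell[OF assms] by (rule LeastI_ex)

text \<open>Sharing the index at one level forces sharing it at all coarser levels, so the search
  for the least level tests the same cells for \<open>x\<close> and \<open>y\<close> and stops at
  the same place.\<close>

lemma level_locally_constant:
  assumes "open U" "x \<in> U" "idx (level U x) y = idx (level U x) x"
  shows "level U y = level U x" "y \<in> U"
proof -
  let ?n = "level U x"
  have sub: "cell ?n (idx ?n y) \<subseteq> U" using level_cell[OF assms(1,2)] assms(3) by simp
  then show "y \<in> U" using mem_cell_idx by blast
  show "level U y = ?n"
    unfolding level_def[of U y]
  proof (rule Least_equality)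
    show "?n \<le> m" if "cell m (idx m y) \<subseteq> U" for m
    proof (rule ccontr)
      assume "\<not> ?n \<le> m"
      then have "m < ?n" "idx m y = idx m x" using idx_eq_coarser[OF assms(3)] by auto
      then show False using that not_less_Least[of m "\<lambda>n. cell n (idx n x) \<subseteq> U"]
        unfolding level_def by simp
    qed
  qed (use sub in simp)
qed

text \<open>By \<open>gap\<close> the rescaled coordinate is not an integer, and the floor is
  locally constant off the integers.\<close>

lemma idx_nbhd:
  assumes "x \<in> S"
  shows "\<exists>e>0. \<forall>y. dist y x < e \<longrightarrow> idx n y = idx n x"
proof -
  have "2 ^ n * (x - c) \<notin> \<int>" by (rule gap[OF assms])
  then have ev: "\<forall>\<^sub>F z in nhds (2 ^ n * (x - c)). \<lfloor>z\<rfloor> = \<lfloor>2 ^ n * (x - c)\<rfloor>"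
    using eventually_floor_eq[OF filterlim_ident] by blast
  have "filterlim (\<lambda>y. 2 ^ n * (y - c)) (nhds (2 ^ n * (x - c))) (nhds x)"
    by (intro tendsto_intros filterlim_ident)
  then have "\<forall>\<^sub>F y in nhds x. idx n y = idx n x"
    unfolding idx_def using ev by (rule eventually_compose_filterlim[rotated])
  then show ?thesis unfolding eventually_nhds_metric .
qed

text \<open>Integer translates of one point of \<open>S\<close>, shrunk by \<open>2 ^ n\<close>,
  stay in \<open>S\<close> and form a grid of mesh \<open>1 / 2 ^ n\<close>.\<close>

lemma dense: "U \<subseteq> closure (S \<inter> U)" if "open U" for U
proof
  fix x assume "x \<in> U"
  obtain s where s: "s \<in> S" using nonempty by blast
  have "\<exists>y\<in>S. dist y x < e" if "e > 0" for e
  proof -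
    obtain n where n: "(1/2) ^ n < e" using real_arch_pow_inv[OF \<open>e > 0\<close>, where x = "1/2"] by auto
    \<comment> \<open>Rounding makes \<open>s + ?k\<close> lie within \<open>1\<close> of
      \<open>2 ^ n * x\<close>.\<close>
    let ?k = "\<lfloor>2 ^ n * x - s\<rfloor>" let ?y = "(s + of_int ?k) / 2 ^ n"
    have "2 ^ n * ?y \<in> S" using add_int[OF s] by simp
    then have "?y \<in> S" by (simp only: power2_iff)
    have "2 ^ n * \<bar>?y - x\<bar> = \<bar>2 ^ n * (?y - x)\<bar>" by (simp only: abs_mult) simp
    also have "\<dots> = \<bar>s + of_int ?k - 2 ^ n * x\<bar>" by (simp add: right_diff_distrib)
    also have "\<dots> \<le> 1" by linarith
    finally have "2 ^ n * dist ?y x \<le> 1" unfolding dist_real_def .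
    then have "dist ?y x \<le> (1/2) ^ n" by (simp add: power_one_over field_simps)
    then show ?thesis using n \<open>?y \<in> S\<close> by force
  qed
  then have "x \<in> closure S" by (auto simp: closure_approachable)
  then show "x \<in> closure (S \<inter> U)" using \<open>x \<in> U\<close> that
    by (metis IntI inf_commute open_Int_closure_subset subsetD)
qed

text \<open>Labels of the largest cells in \<open>U\<close>; the traces of these cells partition
  \<open>S \<inter> U\<close>.\<close>

definition pieces :: "real set \<Rightarrow> (nat \<times> int) set" where
  "pieces U = (\<lambda>x. (level U x, idx (level U x) x)) ` (S \<inter> U)"

text \<open>Finitely many pieces would make the open set \<open>U\<close> a finite union of compact cells.\<close>

lemma infinite_pieces:
  assumes "open U" "U \<noteq> {}"
  shows "infinite (pieces U)"
proof
  assume fin: "finite (pieces U)"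
  define C where "C = (\<Union>(n,k)\<in>pieces U. cell n k)"
  have C: "compact C" unfolding C_def cell_def using fin by (intro compact_UN) auto
  have "S \<inter> U \<subseteq> C" unfolding C_def pieces_def using mem_cell_idx by fastforce
  then have "U \<subseteq> C" using dense[OF assms(1)] closure_minimal compact_imp_closed[OF C] by blast
  moreover have "C \<subseteq> U" unfolding C_def pieces_def using level_cell[OF assms(1)] by auto
  ultimately have "compact U" using C by (metis subset_antisym)
  \<comment> \<open>A nonempty clopen subset of the connected line is the whole line, which is not
    compact.\<close>
  then have "closed U" "U \<noteq> UNIV" by (auto simp: compact_imp_closed not_compact_UNIV)
  then show False using assms clopen[of U] by blast
qed

text \<open>Rescaling a cell of level \<open>n\<close> to unit length carries its trace on \<open>S\<close> to the unit interval
  of \<open>S - 2 ^ n * c\<close>, which depends on \<open>n\<close>. Taking the fractional part of \<open>2 ^ n * x - c\<close> instead is an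
  interval exchange, continuous on \<open>S\<close>, with image the unit interval of \<open>S - c\<close> for every \<open>n\<close>.\<close>

lemma open_homeomorphic_product:
  assumes U: "open U" "U \<noteq> {}"
  shows "(S \<inter> U) homeomorphic ({t. t + c \<in> S \<and> 0 < t \<and> t < 1} \<times> (UNIV :: nat set))"
proof -
  let ?T = "{t. t + c \<in> S \<and> 0 < t \<and> t < 1}"
  let ?J = "pieces U"
  \<comment> \<open>The pieces are countably infinite, so the discrete space \<open>nat\<close> can
    number them; \<open>e\<close> and \<open>d\<close> are the two directions of the
    numbering.\<close>
  define e where "e = to_nat_on ?J"
  define d where "d = from_nat_into ?J"
  have infJ: "infinite ?J" by (rule infinite_pieces[OF U])
  have dJ: "d i \<in> ?J" for i unfolding d_def using infJ by (metis finite.emptyI from_nat_into)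
  have ed: "e (d i) = i" for i unfolding e_def d_def using infJ by simp
  have de: "d (e j) = j" if "j \<in> ?J" for j unfolding e_def d_def using that by simp
  \<comment> \<open>Inverts the interval exchange: \<open>frac (2 ^ n * x - c) = t\<close> makes
    \<open>2 ^ n * (x - c)\<close> agree with \<open>t + c - 2 ^ n * c\<close> modulo integers, and
    \<open>k\<close> supplies the integer part.\<close>
  define pt where "pt = (\<lambda>n k t. c + (of_int k + frac (t + c - 2 ^ n * c)) / 2 ^ n)"
  define f where "f = (\<lambda>x. (frac (2 ^ level U x * x - c), e (level U x, idx (level U x) x)))"
  define g where "g = (\<lambda>(t, i). pt (fst (d i)) (snd (d i)) t)"
  \<comment> \<open>An integer difference from \<open>t + c\<close> gives both membership in
    \<open>S\<close> and the recovery of \<open>t\<close>.\<close>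
  have scale: "2 ^ n * pt n k t = t + c + of_int (k - \<lfloor>t + c - 2 ^ n * c\<rfloor>)" for n k t
    unfolding pt_def frac_def by (simp add: field_simps)
  have pt_S: "pt n k t \<in> S" if "t \<in> ?T" for n k t
  proof -
    have "2 ^ n * pt n k t \<in> S" unfolding scale using add_int that by blast
    then show ?thesis by (simp only: power2_iff)
  qed
  have pt_idx: "idx n (pt n k t) = k" for n k t
  proof -
    have "2 ^ n * (pt n k t - c) = of_int k + frac (t + c - 2 ^ n * c)"
      unfolding pt_def by simp
    then show ?thesis unfolding idx_def by (simp add: floor_eq_iff frac_lt_1)
  qed
  have pt_frac: "frac (2 ^ n * pt n k t - c) = t" if "t \<in> ?T" for n k t
    unfolding scale using that by (simp add: frac_unique_iff)
  have pt_level: "level U (pt n k t) = n" "pt n k t \<in> U" if J: "(n, k) \<in> ?J" for n k t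
  proof -
    obtain x where "x \<in> U" "n = level U x" "k = idx n x" using J unfolding pieces_def by auto
    then show "level U (pt n k t) = n" "pt n k t \<in> U"
      using level_locally_constant[OF U(1), of x "pt n k t"] pt_idx by auto
  qed
  have f_mem: "f x \<in> ?T \<times> UNIV" if x: "x \<in> S \<inter> U" for x
  proof -
    let ?y = "2 ^ level U x * x"
    have y: "?y \<in> S" using x by (simp add: power2_iff)
    have "frac (?y - c) + c = ?y + of_int (- \<lfloor>?y - c\<rfloor>)" by (simp add: frac_def)
    then have "frac (?y - c) + c \<in> S" using add_int[OF y] by metis
    moreover have "?y - c \<notin> \<int>" using gap[OF y, of 0] by simp
    ultimately show ?thesis unfolding f_def by (simp add: frac_lt_1)
  qed
  have gf: "g (f x) = x" if x: "x \<in> S \<inter> U" for x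
  proof -
    let ?n = "level U x"
    have "(?n, idx ?n x) \<in> ?J" using x unfolding pieces_def by blast
    then have "g (f x) = pt ?n (idx ?n x) (frac (2 ^ ?n * x - c))" unfolding g_def f_def by (simp add: de)
    moreover have "frac (frac (2 ^ ?n * x - c) + c - 2 ^ ?n * c) = frac (2 ^ ?n * (x - c))"
    proof -
      have "frac (2 ^ ?n * x - c) + c - 2 ^ ?n * c = 2 ^ ?n * (x - c) + of_int (- \<lfloor>2 ^ ?n * x - c\<rfloor>)"
        by (simp add: frac_def algebra_simps)
      then show ?thesis by (metis frac_add_of_int_right)
    qed
    moreover have "of_int (idx ?n x) + frac (2 ^ ?n * (x - c)) = 2 ^ ?n * (x - c)"
      unfolding idx_def frac_def by simp
    ultimately show ?thesis unfolding pt_def by simp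
  qed
  have g_mem: "g p \<in> S \<inter> U" and fg: "f (g p) = p" if p: "p \<in> ?T \<times> UNIV" for p
  proof -
    obtain t i where [simp]: "p = (t, i)" and t: "t \<in> ?T" using p by blast
    obtain n k where nk: "d i = (n, k)" by fastforce
    then have J: "(n, k) \<in> ?J" by (metis dJ)
    have g: "g p = pt n k t" unfolding g_def by (simp add: nk)
    show "g p \<in> S \<inter> U" unfolding g using pt_S[OF t] pt_level[OF J] by simp
    show "f (g p) = p" unfolding g unfolding f_def pt_level(1)[OF J] pt_idx pt_frac[OF t]
      using ed[of i] nk by simp
  qed
  \<comment> \<open>Near a point of \<open>S\<close> the level and the index are constant, so
    \<open>f\<close> is there the fractional part of an affine map, away from its jumps, paired with
    a constant.\<close>
  have "continuous (at x within S \<inter> U) f" if x: "x \<in> S \<inter> U" for x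
  proof -
    let ?n = "level U x"
    obtain r where r: "r > 0" "\<And>y. dist y x < r \<Longrightarrow> idx ?n y = idx ?n x" using idx_nbhd x by blast
    have ni: "2 ^ ?n * x - c \<notin> \<int>" using gap[of "2 ^ ?n * x" 0] x by (simp add: power2_iff)
    have "isCont (\<lambda>y. 2 ^ ?n * y - c) x" by (intro continuous_intros)
    then have "isCont (\<lambda>y. frac (2 ^ ?n * y - c)) x" using isCont_frac[OF ni] by (rule isCont_o2)
    then have "continuous (at x within S \<inter> U) (\<lambda>y. (frac (2 ^ ?n * y - c), e (?n, idx ?n x)))"
      using continuous_Pair[OF continuous_at_imp_continuous_at_within continuous_const] by blast
    then show ?thesis
    proof (rule continuous_transform_within[OF _ r(1) x])
      fix y assume "dist y x < r"
      then have "idx ?n y = idx ?n x" by (rule r(2))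
      moreover from this have "level U y = ?n"
        using level_locally_constant(1)[OF U(1)] x by blast
      ultimately show "(frac (2 ^ ?n * y - c), e (?n, idx ?n x)) = f y" unfolding f_def by simp
    qed
  qed
  then have cf: "continuous_on (S \<inter> U) f" by (simp add: continuous_on_eq_continuous_within)
  have "continuous (at p within ?T \<times> UNIV) g" if p: "p \<in> ?T \<times> UNIV" for p
  proof -
    obtain t i where [simp]: "p = (t, i)" and t: "t \<in> ?T" using p by blast
    obtain n k where nk: "d i = (n, k)" by fastforce
    \<comment> \<open>\<open>gap\<close> at the point \<open>(t + c) / 2 ^ n\<close> keeps the
      argument of \<open>frac\<close> in \<open>pt\<close> off the integers, where
      \<open>frac\<close> jumps.\<close>
    have "2 ^ n * ((t + c) / 2 ^ n) \<in> S" using t by simp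
    then have "(t + c) / 2 ^ n \<in> S" by (simp only: power2_iff)
    from gap[OF this, of n] have ni: "fst p + c - 2 ^ n * c \<notin> \<int>" by (simp add: right_diff_distrib)
    have "isCont (\<lambda>q. fst q + c - 2 ^ n * c) p" by (intro continuous_intros)
    then have "isCont (\<lambda>q. frac (fst q + c - 2 ^ n * c)) p" using isCont_frac[OF ni] by (rule isCont_o2)
    then have "isCont (\<lambda>q. pt n k (fst q)) p"
      unfolding pt_def by (intro continuous_intros) auto
    then have "continuous (at p within ?T \<times> UNIV) (\<lambda>q. pt n k (fst q))"
      by (rule continuous_at_imp_continuous_at_within)
    \<comment> \<open>Since \<open>nat\<close> is discrete, the slice at \<open>i\<close> is open,
      and \<open>g\<close> is the single map \<open>pt n k\<close> on it.\<close>
    moreover have "openin (top_of_set (?T \<times> UNIV)) (?T \<times> {i})"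
      by (intro openin_Times) (auto simp: open_discrete)
    ultimately show ?thesis
      by (rule continuous_transform_within_openin) (use t in \<open>auto simp: g_def nk\<close>)
  qed
  then have cg: "continuous_on (?T \<times> UNIV) g" by (simp add: continuous_on_eq_continuous_within)
  have "homeomorphism (S \<inter> U) (?T \<times> UNIV) f g"
  proof (rule homeomorphismI[OF cf cg])
    show "f ` (S \<inter> U) \<subseteq> ?T \<times> UNIV" using f_mem by (rule image_subsetI)
    show "g ` (?T \<times> UNIV) \<subseteq> S \<inter> U" using g_mem by (rule image_subsetI)
  qed (fact gf fg)+
  then show ?thesis unfolding homeomorphic_def by blast
qed

text \<open>The product in \<open>open_homeomorphic_product\<close> does not mention
  \<open>U\<close>, so it is a common model.\<close>

lemma open_homeomorphic:
  assumes "open U" "U \<noteq> {}" "open V" "V \<noteq> {}"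
  shows "(S \<inter> U) homeomorphic (S \<inter> V)"
  using open_homeomorphic_product[OF assms(1,2)] open_homeomorphic_product[OF assms(3,4)]
  by (metis homeomorphic_sym homeomorphic_trans)

end

section \<open>The rationals and the irrationals as instances\<close>

lemma ex_irrational: "\<exists>x::real. x \<notin> \<rat>"
  using uncountable_UNIV_real countable_rat by (metis UNIV_eq_I)

text \<open>An irrational base makes every grid point \<open>c + k / 2 ^ n\<close>
  irrational.\<close>

lemma dyadic_grid_gap_Rats:
  assumes c: "c \<notin> \<rat>"
  shows "dyadic_grid_gap \<rat> c"
proof
  fix x :: real and n :: nat
  assume x: "x \<in> \<rat>"
  show "2 ^ n * (x - c) \<notin> \<int>"
  proof
    assume "2 ^ n * (x - c) \<in> \<int>"
    then obtain k :: int where "2 ^ n * (x - c) = of_int k" by (auto elim: Ints_cases)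
    then have "c = x - of_int k / 2 ^ n" by (simp add: field_simps)
    also have "\<dots> \<in> \<rat>" using x by simp
    finally show False using c by simp
  qed
next
  fix x :: real
  show "2 * x \<in> \<rat> \<longleftrightarrow> x \<in> \<rat>"
    using Rats_mult[of "1/2" "2 * x"] by auto
qed auto

text \<open>With base \<open>0\<close> the grid points are the dyadic rationals.\<close>

lemma dyadic_grid_gap_irrationals: "dyadic_grid_gap (- \<rat>) 0"
proof
  fix x :: real and n :: nat
  assume x: "x \<in> - \<rat>"
  have "x = 2 ^ n * (x - 0) / 2 ^ n" by simp
  then show "2 ^ n * (x - 0) \<notin> \<int>" using x Ints_subset_Rats
    by (metis ComplD Rats_divide Rats_number_of Rats_power subsetD)
next
  fix x :: real and k :: int
  assume "x \<in> - \<rat>"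
  then show "x + of_int k \<in> - \<rat>" using Rats_diff[of "x + of_int k" "of_int k"] by auto
next
  fix x :: real
  show "2 * x \<in> - \<rat> \<longleftrightarrow> x \<in> - \<rat>"
    using Rats_mult[of "1/2" "2 * x"] by auto
next
  show "- \<rat> \<noteq> ({} :: real set)" using ex_irrational by blast
qed

subsection \<open>Gluing homeomorphisms and general facts on cards\<close>

text \<open>The maps and their inverses are glued separately by the closed pasting lemma. Agreement
  on both overlaps gives continuity and makes the glued maps mutually inverse.\<close>

lemma homeomorphic_space_paste:
  assumes A: "closedin X A" and B: "closedin X B" and AB: "topspace X = A \<union> B"
    and C: "closedin Y C" and D: "closedin Y D" and CD: "topspace Y = C \<union> D"
    and f: "homeomorphic_maps (subtopology X A) (subtopology Y C) f f'"
    and g: "homeomorphic_maps (subtopology X B) (subtopology Y D) g g'"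
    and fg: "\<And>x. x \<in> A \<inter> B \<Longrightarrow> f x = g x"
    and fg': "\<And>y. y \<in> C \<inter> D \<Longrightarrow> f' y = g' y"
  shows "X homeomorphic_space Y"
proof -
  define h where "h = (\<lambda>x. if x \<in> A then f x else g x)"
  define h' where "h' = (\<lambda>y. if y \<in> C then f' y else g' y)"
  have paste: "continuous_map X' Y' (\<lambda>x. if x \<in> A' then p x else q x)"
    if "closedin X' A'" "closedin X' B'" "topspace X' = A' \<union> B'"
      "continuous_map (subtopology X' A') Y' p" "continuous_map (subtopology X' B') Y' q"
      "\<And>x. x \<in> A' \<inter> B' \<Longrightarrow> p x = q x"
    for X' :: "'c topology" and Y' :: "'d topology" and A' B' p q
    by (rule pasting_lemma_closed[where I = UNIV and T = "\<lambda>b. if b then A' else B'"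
          and f = "\<lambda>b. if b then p else q"])
      (use that in \<open>auto split: if_splits\<close>)
  have "continuous_map X Y h" unfolding h_def
    by (rule paste[OF A B AB])
      (use f g fg in \<open>auto simp: homeomorphic_maps_def continuous_map_in_subtopology\<close>)
  moreover have "continuous_map Y X h'" unfolding h'_def
    by (rule paste[OF C D CD])
      (use f g fg' in \<open>auto simp: homeomorphic_maps_def continuous_map_in_subtopology\<close>)
  moreover have "h' (h x) = x" if "x \<in> topspace X" for x
  proof -
    have "f x \<in> C \<and> f' (f x) = x" if "x \<in> A"
      using f that closedin_subset[OF A] by (auto simp: homeomorphic_maps_def continuous_map_def Pi_iff)
    moreover have "g x \<in> D \<and> g' (g x) = x" if "x \<in> B"
      using g that closedin_subset[OF B] by (auto simp: homeomorphic_maps_def continuous_map_def Pi_iff)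
    ultimately show ?thesis using that AB fg' unfolding h_def h'_def by fastforce
  qed
  moreover have "h (h' y) = y" if "y \<in> topspace Y" for y
  proof -
    have "f' y \<in> A \<and> f (f' y) = y" if "y \<in> C"
      using f that closedin_subset[OF C] by (auto simp: homeomorphic_maps_def continuous_map_def Pi_iff)
    moreover have "g' y \<in> B \<and> g (g' y) = y" if "y \<in> D"
      using g that closedin_subset[OF D] by (auto simp: homeomorphic_maps_def continuous_map_def Pi_iff)
    ultimately show ?thesis using that CD fg unfolding h_def h'_def by fastforce
  qed
  ultimately show ?thesis unfolding homeomorphic_space_def homeomorphic_maps_def by blast
qed

text \<open>Complementary open parts are also closed, so pasting applies with empty
  overlaps.\<close>

lemma homeomorphic_space_disjoint_union:
  assumes A: "openin X A" and B: "openin X B" and AB: "topspace X = A \<union> B" "A \<inter> B = {}"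
    and C: "openin Y C" and D: "openin Y D" and CD: "topspace Y = C \<union> D" "C \<inter> D = {}"
    and f: "subtopology X A homeomorphic_space subtopology Y C"
    and g: "subtopology X B homeomorphic_space subtopology Y D"
  shows "X homeomorphic_space Y"
proof -
  have "topspace X - A = B" "topspace X - B = A" "topspace Y - C = D" "topspace Y - D = C"
    using AB CD by auto
  then have "closedin X A" "closedin X B" "closedin Y C" "closedin Y D"
    using A B C D by (metis openin_closedin_eq closedin_def openin_subset)+
  then show ?thesis
    using f g homeomorphic_space_paste[of X A B Y C D] AB CD unfolding homeomorphic_space_def by blast
qed

lemma homeomorphic_imp_homeomorphic_space:
  assumes "S homeomorphic T"
  shows "top_of_set S homeomorphic_space top_of_set T"
proof -
  obtain f g where "homeomorphism S T f g" using assms homeomorphic_def by blast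
  then have "homeomorphic_maps (top_of_set S) (top_of_set T) f g"
    unfolding homeomorphism_def homeomorphic_maps_def by auto
  then show ?thesis unfolding homeomorphic_space_def by blast
qed

section \<open>Cards and separation axioms\<close>

lemma topspace_card_at [simp]: "topspace (card_at X x) = topspace X - {x}"
  unfolding card_at_def by auto

lemma card_at_top_of_set: "card_at (top_of_set S) x = top_of_set (S - {x})"
proof -
  have "S \<inter> (S - {x}) = S - {x}" by blast
  then show ?thesis unfolding card_at_def by (simp add: subtopology_subtopology)
qed

text \<open>As \<open>{x}\<close> is closed in the card at \<open>z\<close>, its closure in
  \<open>Z\<close> can gain only \<open>z\<close>; a second choice of \<open>z\<close> excludes
  that. Then cards are open, and \<open>x\<close> and \<open>y\<close> are separated inside the card
  at a third point. Infinity supplies the spare points.\<close>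

lemma Hausdorff_space_if_cards:
  assumes cards: "\<And>z. z \<in> topspace Z \<Longrightarrow> Hausdorff_space (card_at Z z)"
    and inf: "infinite (topspace Z)"
  shows "Hausdorff_space Z"
proof -
  have ex: "\<exists>z\<in>topspace Z. z \<notin> F" if "finite F" for F
    using inf finite_subset[OF _ that] by blast
  have closed_pt: "closedin Z {x}" if x: "x \<in> topspace Z" for x
  proof -
    have clo: "Z closure_of {x} \<subseteq> {x, z}" if z: "z \<in> topspace Z" "z \<noteq> x" for z
    proof -
      have "closedin (card_at Z z) {x}"
        using cards[OF z(1)] x z by (intro closedin_Hausdorff_singleton) auto
      then have "card_at Z z closure_of {x} = {x}" by (rule closure_of_closedin)
      then show ?thesis
        using z x closure_of_subset_topspace[of Z "{x}"]
        unfolding card_at_def closure_of_subtopology by auto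
    qed
    obtain z where z: "z \<in> topspace Z" "z \<notin> {x}" using ex[of "{x}"] by blast
    obtain z' where z': "z' \<in> topspace Z" "z' \<notin> {x, z}" using ex[of "{x, z}"] by blast
    have "Z closure_of {x} \<subseteq> {x}" using clo[of z] clo[of z'] z z' by blast
    then show ?thesis using x closure_of_subset_eq[of "{x}" Z] by blast
  qed
  show ?thesis
    unfolding Hausdorff_space_def
  proof (intro allI impI)
    fix x y assume xy: "x \<in> topspace Z \<and> y \<in> topspace Z \<and> x \<noteq> y"
    obtain z where z: "z \<in> topspace Z" "z \<notin> {x, y}" using ex[of "{x, y}"] by blast
    have op: "openin Z (topspace Z - {z})" using closed_pt[OF z(1)] by blast
    obtain U V where "openin (card_at Z z) U" "openin (card_at Z z) V" "x \<in> U" "y \<in> V" "disjnt U V"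
      using cards[OF z(1)] xy z unfolding Hausdorff_space_def by (metis DiffI insertI1 insertI2 singletonD topspace_card_at)
    then show "\<exists>U V. openin Z U \<and> openin Z V \<and> x \<in> U \<and> y \<in> V \<and> disjnt U V"
      unfolding card_at_def using openin_trans_full[OF _ op] by blast
  qed
qed

lemma reconstruction_Hausdorff:
  assumes rec: "is_reconstruction Z X" and "Hausdorff_space X" and "infinite (topspace X)"
  shows "infinite (topspace Z)" "Hausdorff_space Z"
proof -
  obtain x where "x \<in> topspace X" using assms(3) by fastforce
  then obtain z where z: "card_at X x homeomorphic_space card_at Z z"
    using rec unfolding is_reconstruction_def by blast
  then obtain f where "homeomorphic_map (card_at X x) (card_at Z z) f"
    unfolding homeomorphic_space by blast
  then have "bij_betw f (topspace X - {x}) (topspace Z - {z})"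
    unfolding bij_betw_def
    by (metis homeomorphic_imp_injective_map homeomorphic_imp_surjective_map topspace_card_at)
  then have "infinite (topspace Z - {z})" using assms(3) bij_betw_finite by fastforce
  then show inf: "infinite (topspace Z)" by auto
  have "Hausdorff_space (card_at X x)" for x
    unfolding card_at_def using assms(2) by (rule Hausdorff_space_subtopology)
  then have "Hausdorff_space (card_at Z z)" if "z \<in> topspace Z" for z
    using rec that homeomorphic_Hausdorff_space unfolding is_reconstruction_def by blast
  then show "Hausdorff_space Z" using inf by (rule Hausdorff_space_if_cards)
qed

text \<open>Removing a closed point leaves an open subspace.\<close>

lemma openin_card_at:
  assumes "t1_space Z"
  shows "openin (card_at Z w) U \<longleftrightarrow> openin Z U \<and> w \<notin> U"
proof -
  have "openin Z (topspace Z - {w})"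
    using assms unfolding t1_space_closedin_singleton
    by (metis Diff_empty Diff_insert0 openin_diff openin_topspace)
  from openin_open_subtopology[OF this, of U] show ?thesis
    unfolding card_at_def using openin_subset[of Z U] by blast
qed

subsection \<open>Zero-dimensional case\<close>

context dyadic_grid_gap
begin

lemma c_notin: "c \<notin> S"
  using gap[of c 0] by auto

lemma infinite_S: "infinite S"
proof -
  obtain s where s: "s \<in> S" using nonempty by blast
  have "inj (\<lambda>k::int. s + of_int k)" by (auto simp: inj_def)
  then have "infinite (range (\<lambda>k::int. s + of_int k))"
    using finite_imageD infinite_UNIV_int by blast
  moreover have "range (\<lambda>k::int. s + of_int k) \<subseteq> S" using add_int s by blast
  ultimately show ?thesis using finite_subset by blast
qed

text \<open>The endpoints are grid points and avoid \<open>S\<close>. The two forms show that the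
  trace is closed and open in \<open>S\<close>.\<close>

lemma cell_S:
  "S \<inter> cell n k = S \<inter> {c + of_int k / 2 ^ n <..< c + (of_int k + 1) / 2 ^ n}"
proof -
  have "c + of_int j / 2 ^ n \<notin> S" for j :: int
    using gap[of "c + of_int j / 2 ^ n" n] by auto
  from this[of k] this[of "k + 1"]
  have "c + of_int k / 2 ^ n \<notin> S" "c + (of_int k + 1) / 2 ^ n \<notin> S" by simp_all
  then have "x \<noteq> c + of_int k / 2 ^ n" "x \<noteq> c + (of_int k + 1) / 2 ^ n" if "x \<in> S" for x
    using that by metis+
  then show ?thesis unfolding cell_def set_eq_iff Int_iff atLeastAtMost_iff greaterThanLessThan_iff
    by (metis order_le_less)
qed

lemma reconstruction_homeomorphic:
  assumes rec: "is_reconstruction Z (top_of_set S)"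
  shows "Z homeomorphic_space top_of_set S"
proof -
  have inf: "infinite (topspace Z)" and haus: "Hausdorff_space Z"
    using reconstruction_Hausdorff[OF rec] infinite_S
    by (simp_all add: Hausdorff_space_subtopology)
  note oc = openin_card_at[OF Hausdorff_imp_t1_space[OF haus]]
  have cards: "\<exists>x f. x \<in> S \<and> homeomorphic_map (card_at Z w) (top_of_set (S - {x})) f"
    if w: "w \<in> topspace Z" for w
  proof -
    have "\<exists>x\<in>S. card_at Z w homeomorphic_space card_at (top_of_set S) x"
      using rec w unfolding is_reconstruction_def by simp
    then obtain x where x: "x \<in> S" "card_at Z w homeomorphic_space top_of_set (S - {x})"
      unfolding card_at_top_of_set by blast
    then obtain f where "homeomorphic_map (card_at Z w) (top_of_set (S - {x})) f"
      using homeomorphic_space by blast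
    with x(1) show ?thesis by blast
  qed
  \<comment> \<open>An open set missing \<open>w\<close> is open in the card at \<open>w\<close>, so
    the homeomorphism of that card carries it onto an open subset of \<open>S\<close>.\<close>
  have piece: "\<exists>U. open U \<and> U \<noteq> {} \<and> subtopology Z A homeomorphic_space top_of_set (S \<inter> U)"
    if A: "openin Z A" "A \<noteq> {}" and w: "w \<in> topspace Z" "w \<notin> A" for A w
  proof -
    obtain x f where f: "homeomorphic_map (card_at Z w) (top_of_set (S - {x})) f" using cards w by blast
    have sub: "A \<subseteq> topspace Z - {w}" using openin_subset[OF A(1)] w by blast
    have "openin (top_of_set (S - {x})) (f ` A)"
      using homeomorphic_map_openness[OF f] sub oc A w by auto
    then obtain V where V: "open V" "f ` A = (S - {x}) \<inter> V" by (auto simp: openin_open)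
    have fA: "f ` (topspace (card_at Z w) \<inter> A) = topspace (top_of_set (S - {x})) \<inter> f ` A"
      using sub V by (auto simp: Int_absorb1)
    have "homeomorphic_map (subtopology (card_at Z w) A) (subtopology (top_of_set (S - {x})) (f ` A)) f"
      using homeomorphic_map_subtopologies[OF f fA] .
    moreover have "subtopology (card_at Z w) A = subtopology Z A"
      unfolding card_at_def subtopology_subtopology using sub by (simp add: Int_absorb1)
    moreover have "subtopology (top_of_set (S - {x})) (f ` A) = top_of_set (S \<inter> (V - {x}))"
      unfolding subtopology_subtopology V by (rule arg_cong[of _ _ top_of_set]) auto
    ultimately have "subtopology Z A homeomorphic_space top_of_set (S \<inter> (V - {x}))"
      using homeomorphic_map_imp_homeomorphic_space by metis
    moreover have "open (V - {x})" using V by auto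
    moreover have "V - {x} \<noteq> {}" using V A by auto
    ultimately show ?thesis by blast
  qed
  obtain z where z: "z \<in> topspace Z" using inf by fastforce
  have "infinite (topspace Z - {z})" using inf by simp
  then obtain w where w: "w \<in> topspace Z" "z \<noteq> w" by (metis Diff_iff ex_in_conv finite.emptyI singletonI)
  \<comment> \<open>\<open>G\<close> will contain the clopen part around \<open>z\<close>;
    \<open>H\<close> is a neighbourhood of \<open>w\<close> avoiding it, which the card at
    \<open>w\<close> cannot provide.\<close>
  obtain G H where GH: "openin Z G" "openin Z H" "z \<in> G" "w \<in> H" "disjnt G H"
    using haus z w unfolding Hausdorff_space_def by blast
  obtain x f where x: "x \<in> S" and f: "homeomorphic_map (card_at Z w) (top_of_set (S - {x})) f"
    using cards w by blast
  have wG: "w \<notin> G" using GH by (auto simp: disjnt_def)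
  have subG: "G \<subseteq> topspace Z - {w}" using openin_subset[OF GH(1)] wG by blast
  have "openin (top_of_set (S - {x})) (f ` G)"
    using homeomorphic_map_openness[OF f] subG oc GH wG by auto
  then obtain W where W: "open W" "f ` G = (S - {x}) \<inter> W" by (auto simp: openin_open)
  then have fz: "f z \<in> W - {x}" using GH by blast
  obtain n where n: "cell n (idx n (f z)) \<subseteq> W - {x}"
    using small_cell[OF _ fz] W by blast
  let ?C = "cell n (idx n (f z))"
  \<comment> \<open>The cell lies in \<open>W - {x}\<close>, so \<open>V\<close> falls inside
    \<open>G\<close>; its trace on \<open>S\<close> is clopen, so \<open>V\<close> is clopen in the
    card at \<open>w\<close>.\<close>
  define V where "V = {v \<in> topspace Z - {w}. f v \<in> ?C}"
  have cont: "continuous_map (card_at Z w) (top_of_set (S - {x})) f"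
    using f homeomorphic_imp_continuous_map by blast
  then have fS: "f v \<in> S - {x}" if "v \<in> topspace Z - {w}" for v
    using that by (auto simp: continuous_map_def Pi_iff)
  have contR: "continuous_map (card_at Z w) euclideanreal f"
    using cont continuous_map_in_subtopology by blast
  have V_eq: "V = {v \<in> topspace (card_at Z w). f v \<in>
      {c + of_int (idx n (f z)) / 2 ^ n <..< c + (of_int (idx n (f z)) + 1) / 2 ^ n}}"
    unfolding V_def using fS cell_S[of n "idx n (f z)"] by auto
  have "openin (card_at Z w) V"
    unfolding V_eq by (rule openin_continuous_map_preimage[OF contR]) simp
  then have oV: "openin Z V" by (simp add: oc)
  have "{v \<in> topspace (card_at Z w). f v \<in> - ?C} = topspace Z - {w} - V" unfolding V_def by auto
  moreover have "open (- ?C)" unfolding cell_def by auto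
  ultimately have "openin (card_at Z w) (topspace Z - {w} - V)"
    using openin_continuous_map_preimage[OF contR, of "- ?C"] by simp
  then have oV': "openin Z (topspace Z - {w} - V)" by (simp add: oc)
  have "V \<subseteq> G"
  proof
    fix v assume v: "v \<in> V"
    then have "f v \<in> f ` G" using n fS W unfolding V_def by blast
    then obtain u where u: "u \<in> G" "f u = f v" by force
    have "inj_on f (topspace Z - {w})" using homeomorphic_imp_injective_map[OF f] by simp
    then have "u = v" using u v subG unfolding V_def inj_on_def by auto
    then show "v \<in> G" using u by simp
  qed
  \<comment> \<open>The complement of \<open>V\<close> in the card lacks only \<open>w\<close>, and
    \<open>H\<close> restores it by an open set disjoint from \<open>V\<close>.\<close>
  then have "topspace Z - V = (topspace Z - {w} - V) \<union> H"
    using GH openin_subset[OF GH(2)] by (auto simp: disjnt_def)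
  then have oV'': "openin Z (topspace Z - V)" using oV' GH(2) by (metis openin_Un)
  have zV: "z \<in> V" unfolding V_def using z w mem_cell_idx by simp
  have wV: "w \<in> topspace Z - V" unfolding V_def using w by simp
  \<comment> \<open>\<open>V\<close> misses \<open>w\<close> and its complement misses
    \<open>z\<close>, so \<open>piece\<close> applies to both.\<close>
  obtain U1 where U1: "open U1" "U1 \<noteq> {}" "subtopology Z V homeomorphic_space top_of_set (S \<inter> U1)"
    using piece[OF oV, of w] zV wV by blast
  obtain U2 where U2: "open U2" "U2 \<noteq> {}"
      "subtopology Z (topspace Z - V) homeomorphic_space top_of_set (S \<inter> U2)"
    using piece[OF oV'', of z] zV wV z by blast
  \<comment> \<open>All nonempty open traces being homeomorphic, the two half-lines at
    \<open>c\<close> may be chosen as targets; they partition \<open>S\<close> because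
    \<open>c\<close> is not in it.\<close>
  have "subtopology Z V homeomorphic_space top_of_set (S \<inter> {..<c})"
    using U1(3) homeomorphic_imp_homeomorphic_space[OF open_homeomorphic[OF U1(1,2), of "{..<c}"]]
      homeomorphic_space_trans by fastforce
  then have e1: "subtopology Z V homeomorphic_space subtopology (top_of_set S) (S \<inter> {..<c})"
    by (simp add: subtopology_subtopology)
  have "subtopology Z (topspace Z - V) homeomorphic_space top_of_set (S \<inter> {c<..})"
    using U2(3) homeomorphic_imp_homeomorphic_space[OF open_homeomorphic[OF U2(1,2), of "{c<..}"]]
      homeomorphic_space_trans by fastforce
  then have e2: "subtopology Z (topspace Z - V) homeomorphic_space subtopology (top_of_set S) (S \<inter> {c<..})"
    by (simp add: subtopology_subtopology)
  have split: "x < c \<or> c < x" if "x \<in> S" for x using c_notin that by (metis linorder_cases)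
  show ?thesis
  proof (rule homeomorphic_space_disjoint_union[OF oV oV'' _ _ _ _ _ _ e1 e2])
    show "topspace Z = V \<union> (topspace Z - V)" using openin_subset[OF oV] by blast
    show "topspace (top_of_set S) = S \<inter> {..<c} \<union> S \<inter> {c<..}" using split by auto
    show "openin (top_of_set S) (S \<inter> {..<c})" "openin (top_of_set S) (S \<inter> {c<..})"
      by (simp_all add: openin_open_Int)
  qed auto
qed

end

subsection \<open>The real line\<close>

lemma ray_homeomorphic_UNIV:
  fixes x :: real
  shows "{..<x} homeomorphic (UNIV :: real set)" "{x<..} homeomorphic (UNIV :: real set)"
proof -
  have "homeomorphism {..<x} UNIV (\<lambda>t. - ln (x - t)) (\<lambda>s. x - exp (- s))"
    by (rule homeomorphismI) (auto intro!: continuous_intros)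
  then show "{..<x} homeomorphic (UNIV :: real set)" unfolding homeomorphic_def by blast
  have "homeomorphism {x<..} UNIV (\<lambda>t. ln (t - x)) (\<lambda>s. x + exp s)"
    by (rule homeomorphismI) (auto intro!: continuous_intros)
  then show "{x<..} homeomorphic (UNIV :: real set)" unfolding homeomorphic_def by blast
qed

text \<open>The halves are the preimages of the two open rays at \<open>x\<close>; they are open in
  \<open>Z\<close>, not just in the card, because points are closed.\<close>

lemma card_halves:
  fixes x :: real
  assumes Z: "t1_space Z" and h: "card_at Z z homeomorphic_space top_of_set (UNIV - {x})"
  obtains L M where "openin Z L" "openin Z M" "L \<inter> M = {}" "L \<union> M = topspace Z - {z}"
    "subtopology Z L homeomorphic_space euclideanreal"
    "subtopology Z M homeomorphic_space euclideanreal"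
proof -
  obtain f where f: "homeomorphic_map (card_at Z z) (top_of_set (UNIV - {x})) f"
    using h homeomorphic_space by blast
  have cont: "continuous_map (card_at Z z) euclideanreal f"
    using homeomorphic_imp_continuous_map[OF f] continuous_map_in_subtopology by blast
  have im: "f ` (topspace Z - {z}) = UNIV - {x}"
    using homeomorphic_imp_surjective_map[OF f] by simp
  define P where "P = (\<lambda>R. {v \<in> topspace (card_at Z z). f v \<in> R})"
  have half: "openin Z (P R)" "subtopology Z (P R) homeomorphic_space euclideanreal"
    if R: "open R" "x \<notin> R" "R homeomorphic (UNIV :: real set)" for R
  proof -
    have "openin (card_at Z z) (P R)"
      unfolding P_def by (rule openin_continuous_map_preimage[OF cont]) (use R in simp)
    then show "openin Z (P R)" by (simp add: openin_card_at[OF Z])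
    have "f ` (topspace (card_at Z z) \<inter> P R) = topspace (top_of_set (UNIV - {x})) \<inter> R"
      using im R unfolding P_def by (auto simp: image_iff set_eq_iff)
    then have "homeomorphic_map (subtopology (card_at Z z) (P R)) (subtopology (top_of_set (UNIV - {x})) R) f"
      by (rule homeomorphic_map_subtopologies[OF f])
    moreover have "(topspace Z - {z}) \<inter> P R = P R" unfolding P_def by auto
    then have "subtopology (card_at Z z) (P R) = subtopology Z (P R)"
      unfolding card_at_def subtopology_subtopology by simp
    moreover have "(UNIV - {x}) \<inter> R = R" using R by blast
    then have "subtopology (top_of_set (UNIV - {x})) R = top_of_set R"
      by (simp only: subtopology_subtopology)
    ultimately have "subtopology Z (P R) homeomorphic_space top_of_set R"
      using homeomorphic_map_imp_homeomorphic_space by metis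
    moreover have "top_of_set R homeomorphic_space euclideanreal"
      using homeomorphic_imp_homeomorphic_space[OF R(3)] by simp
    ultimately show "subtopology Z (P R) homeomorphic_space euclideanreal"
      by (rule homeomorphic_space_trans)
  qed
  have "f v \<noteq> x" if "v \<in> topspace Z - {z}" for v using im that by blast
  then have "P {..<x} \<union> P {x<..} = topspace Z - {z}" unfolding P_def
    by (auto simp: neq_iff)
  moreover have "P {..<x} \<inter> P {x<..} = {}" unfolding P_def by auto
  ultimately show ?thesis
    using that[of "P {..<x}" "P {x<..}"] half[of "{..<x}"] half[of "{x<..}"] ray_homeomorphic_UNIV[of x]
    by simp
qed

lemma connectedin_if_homeomorphic_real:
  assumes "openin Z L" "subtopology Z L homeomorphic_space euclideanreal"
  shows "connectedin Z L"
proof -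
  have "connected_space euclideanreal"
    using connected_UNIV connectedin_topspace by (metis connectedin_iff_connected topspace_euclidean)
  then have "connected_space (subtopology Z L)"
    using assms(2) homeomorphic_connected_space by blast
  then show ?thesis
    unfolding connectedin_def using openin_subset[OF assms(1)] by simp
qed

lemma connectedin_open_cases:
  assumes "connectedin Z C" "openin Z A" "openin Z B" "A \<inter> B = {}" "C \<subseteq> A \<union> B"
  shows "C \<subseteq> A \<or> C \<subseteq> B"
proof (rule ccontr)
  assume "\<not> (C \<subseteq> A \<or> C \<subseteq> B)"
  then have "A \<inter> C \<noteq> {}" "B \<inter> C \<noteq> {}" using assms(5) by blast+
  moreover have "A \<inter> B \<inter> C = {}" using assms(4) by blast
  ultimately show False using assms(1,2,3,5) unfolding connectedin by blast
qed

text \<open>Off \<open>y\<close> the set \<open>I\<close> is both open and closed, so an open ray at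
  \<open>y\<close> that meets \<open>I\<close> lies inside it; connectedness allows only one of the
  two rays.\<close>

lemma closed_real_ray:
  fixes I :: "real set"
  assumes "closed I" "open (I - {y})" "connected (I - {y})" "I - {y} \<noteq> {}" "y \<in> I"
  shows "I = {..y} \<or> I = {y..}"
proof -
  have fill: "R \<subseteq> I" if R: "connected R" "open R" "y \<notin> R" "(I - {y}) \<inter> R \<noteq> {}" for R
  proof (rule ccontr)
    assume "\<not> R \<subseteq> I"
    moreover have "R \<subseteq> (I - {y}) \<union> - I" using R(3) by blast
    moreover have "open (- I)" using assms(1) by (rule open_Compl)
    ultimately show False
      using connectedD[OF R(1) assms(2), of "- I"] R(4) by blast
  qed
  have "I - {y} \<subseteq> {..<y} \<or> I - {y} \<subseteq> {y<..}"
  proof (rule ccontr)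
    assume *: "\<not> (I - {y} \<subseteq> {..<y} \<or> I - {y} \<subseteq> {y<..})"
    have sub: "I - {y} \<subseteq> {..<y} \<union> {y<..}" by (auto simp: neq_iff)
    have "{..<y} \<inter> (I - {y}) = {} \<or> {y<..} \<inter> (I - {y}) = {}"
      by (rule connectedD[OF assms(3) _ _ _ sub]) auto
    then show False using * sub by blast
  qed
  then show ?thesis
  proof
    assume *: "I - {y} \<subseteq> {..<y}"
    then have "{..<y} \<subseteq> I" by (intro fill) (use assms(4) in auto)
    then have "I - {y} = {..<y}" using * by (intro subset_antisym) auto
    then have "I = insert y {..<y}" using insert_Diff[OF assms(5)] by simp
    then show ?thesis by auto
  next
    assume *: "I - {y} \<subseteq> {y<..}"
    then have "{y<..} \<subseteq> I" by (intro fill) (use assms(4) in auto)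
    then have "I - {y} = {y<..}" using * by (intro subset_antisym) auto
    then have "I = insert y {y<..}" using insert_Diff[OF assms(5)] by simp
    then show ?thesis by auto
  qed
qed

text \<open>Inside the line \<open>L'\<close> the set \<open>insert z L\<close> satisfies
  \<open>closed_real_ray\<close>. The model is normalised to \<open>{..0}\<close> with
  \<open>z\<close> at \<open>0\<close>, ready for gluing.\<close>

lemma real_line_closed_half:
  assumes half: "openin Z L'" "subtopology Z L' homeomorphic_space euclideanreal"
    and L: "openin Z L" "connectedin Z L" "L \<noteq> {}" "z \<notin> L"
    and K: "closedin Z (insert z L)" "insert z L \<subseteq> L'"
  obtains f f' where "homeomorphic_maps (subtopology Z (insert z L)) (top_of_set {..0::real}) f f'"
    "f z = 0" "f' 0 = z"
proof -
  let ?K = "insert z L"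
  obtain p p' where p: "homeomorphic_maps (subtopology Z L') euclideanreal p p'"
    using half(2) unfolding homeomorphic_space_def by blast
  then have pm: "homeomorphic_map (subtopology Z L') euclideanreal p"
    by (rule homeomorphic_maps_imp_map)
  have L'Z: "L' \<subseteq> topspace Z" using openin_subset half(1) by blast
  then have tL': "topspace (subtopology Z L') = L'" by auto
  have p'p: "p' (p v) = v" if "v \<in> L'" for v
    using p that tL' unfolding homeomorphic_maps_def by blast
  have pp': "p (p' r) = r" "p' r \<in> L'" for r
    using p tL' unfolding homeomorphic_maps_def continuous_map_def by auto
  have inj: "inj_on p L'" using p'p by (rule inj_on_inverseI)
  have pL: "p ` ?K - {p z} = p ` L"
    using inj K(2) L(4) unfolding inj_on_def by blast
  have "closedin (subtopology Z L') ?K"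
    using K by (simp add: closedin_subset_topspace)
  then have "closed (p ` ?K)"
    using homeomorphic_map_closedness[OF pm, of ?K] K(2) L'Z tL' by auto
  moreover have "openin (subtopology Z L') L"
    using L(1) K(2) half(1) by (simp add: openin_open_subtopology)
  then have "open (p ` ?K - {p z})"
    unfolding pL using homeomorphic_map_openness[OF pm, of L] K(2) L'Z tL' by auto
  moreover have "connectedin (subtopology Z L') L"
    using L(2) K(2) by (simp add: connectedin_subtopology)
  then have "connected (p ` ?K - {p z})"
    unfolding pL using connectedin_continuous_map_image[OF homeomorphic_imp_continuous_map[OF pm]]
    by (simp add: connectedin_iff_connected)
  moreover have "p ` ?K - {p z} \<noteq> {}" unfolding pL using L(3) by simp
  ultimately have rays: "p ` ?K = {..p z} \<or> p ` ?K = {p z..}"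
    by (intro closed_real_ray) auto
  \<comment> \<open>\<open>s\<close> reflects a ray that points to the right;
    \<open>s * s = 1\<close> makes multiplication by \<open>s\<close> its own inverse.\<close>
  define s :: real where "s = (if p ` ?K = {..p z} then 1 else - 1)"
  have s: "s * s = 1" unfolding s_def by simp
  have im: "p ` ?K = {r. s * (r - p z) \<le> 0}" using rays unfolding s_def by auto
  define f where "f = (\<lambda>v. s * (p v - p z))"
  define f' where "f' = (\<lambda>r. p' (p z + s * r))"
  have "homeomorphic_maps euclideanreal euclideanreal (\<lambda>r. s * (r - p z)) (\<lambda>r. p z + s * r)"
    unfolding homeomorphic_maps_def using s
    by (auto intro!: continuous_intros simp: mult.assoc[symmetric])
  then have "homeomorphic_maps (subtopology Z L') euclideanreal f f'"
    using homeomorphic_maps_compose[OF conjI, OF p] unfolding f_def f'_def by (auto simp: o_def)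
  moreover have "f ` (topspace (subtopology Z L') \<inter> ?K) = topspace euclideanreal \<inter> {..0}"
  proof -
    have "f ` ?K = (\<lambda>r. s * (r - p z)) ` p ` ?K" unfolding f_def by (simp add: image_image)
    also have "\<dots> = {..0}" unfolding im
    proof (intro subset_antisym subsetI)
      fix r :: real assume "r \<in> {..0}"
      then have "r = s * ((p z + s * r) - p z) \<and> s * ((p z + s * r) - p z) \<le> 0"
        using s by (simp add: mult.assoc[symmetric])
      then show "r \<in> (\<lambda>r. s * (r - p z)) ` {r. s * (r - p z) \<le> 0}" by blast
    qed auto
    finally show ?thesis using K(2) tL' by (simp add: Int_absorb1)
  qed
  ultimately have "homeomorphic_maps (subtopology (subtopology Z L') ?K) (top_of_set {..0}) f f'"
    by (rule homeomorphic_maps_subtopologies)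
  moreover have "subtopology (subtopology Z L') ?K = subtopology Z ?K"
    using K(2) by (simp only: subtopology_subtopology Int_absorb1)
  ultimately show ?thesis
    using that[of f f'] p'p[of z] K(2) unfolding f_def f'_def by simp
qed

lemma reconstruction_real_line:
  assumes rec: "is_reconstruction Z euclideanreal"
  shows "Z homeomorphic_space euclideanreal"
proof -
  have inf: "infinite (topspace Z)" and haus: "Hausdorff_space Z"
    using reconstruction_Hausdorff[OF rec] by (simp_all add: infinite_UNIV_char_0)
  note t1 = Hausdorff_imp_t1_space[OF haus]
  have cards: "\<exists>x::real. card_at Z w homeomorphic_space top_of_set (UNIV - {x})"
    if "w \<in> topspace Z" for w
    using rec that unfolding is_reconstruction_def card_at_def by simp
  have ray_nonempty: "L \<noteq> {}" if "subtopology Z L homeomorphic_space euclideanreal" for L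
    using that homeomorphic_empty_space[of "subtopology Z L" euclideanreal] by auto
  \<comment> \<open>Stated for arbitrary \<open>z\<close>, \<open>L\<close> and \<open>M\<close>, so
    that exchanging \<open>L\<close> and \<open>M\<close> yields the second ray.\<close>
  have halves: "\<exists>f f'. homeomorphic_maps (subtopology Z (insert z L)) (top_of_set {..0::real}) f f'
      \<and> f z = 0 \<and> f' 0 = z" and closed: "closedin Z (insert z L)"
    if z: "z \<in> topspace Z" and L: "openin Z L" "subtopology Z L homeomorphic_space euclideanreal"
      and M: "openin Z M" "subtopology Z M homeomorphic_space euclideanreal"
      and LM: "L \<inter> M = {}" "L \<union> M = topspace Z - {z}" for z L M
  proof -
    have conL: "connectedin Z L" using L by (rule connectedin_if_homeomorphic_real)
    have "topspace Z - insert z L = M" using LM openin_subset[OF M(1)] by blast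
    then show closed: "closedin Z (insert z L)"
      unfolding closedin_def using M(1) openin_subset[OF L(1)] z by auto
    \<comment> \<open>If \<open>L\<close> were clopen, a point \<open>l\<close> of it would cut it
      into \<open>P\<close> and \<open>Q\<close>, and these with the complement of \<open>L\<close>
      would split the card at \<open>l\<close> into three open pieces.\<close>
    have not_closed: "\<not> closedin Z L"
    proof
      assume cl: "closedin Z L"
      then have opN: "openin Z (topspace Z - L)" by blast
      obtain q where q: "homeomorphic_map (subtopology Z L) euclideanreal q"
        using L(2) homeomorphic_space by blast
      have tL: "topspace (subtopology Z L) = L" using openin_subset[OF L(1)] by auto
      have imq: "q ` L = UNIV" and injq: "inj_on q L"
        using homeomorphic_imp_surjective_map[OF q] homeomorphic_imp_injective_map[OF q] tL by auto
      obtain l where l: "l \<in> L" "q l = 0" using imq by (metis UNIV_I imageE)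
      define P where "P = {v \<in> topspace (subtopology Z L). q v \<in> {..<0}}"
      define Q where "Q = {v \<in> topspace (subtopology Z L). q v \<in> {0<..}}"
      have "openin (subtopology Z L) P" "openin (subtopology Z L) Q"
        unfolding P_def Q_def
        by (rule openin_continuous_map_preimage[OF homeomorphic_imp_continuous_map[OF q]]; simp)+
      then have PQ: "openin Z P" "openin Z Q" using openin_open_subtopology[OF L(1)] by blast+
      have "q v \<noteq> 0" if "v \<in> L" "v \<noteq> l" for v
        using inj_onD[OF injq _ that(1) l(1)] that(2) l(2) by auto
      then have PQL: "P \<union> Q = L - {l}" "P \<inter> Q = {}"
        using l(2) unfolding P_def Q_def tL by (auto simp: neq_iff)
      have "\<exists>v\<in>L. q v = - 1" "\<exists>v\<in>L. q v = 1" using imq by (metis UNIV_I imageE)+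
      then have ne: "P \<noteq> {}" "Q \<noteq> {}" unfolding P_def Q_def tL by auto
      have lZ: "l \<in> topspace Z" using l openin_subset[OF L(1)] by blast
      obtain x :: real where "card_at Z l homeomorphic_space top_of_set (UNIV - {x})" using cards[OF lZ] by blast
      then obtain L' M' where L'M': "openin Z L'" "openin Z M'" "L' \<inter> M' = {}" "L' \<union> M' = topspace Z - {l}"
        "subtopology Z L' homeomorphic_space euclideanreal"
        "subtopology Z M' homeomorphic_space euclideanreal"
        by (rule card_halves[OF t1])
      have three: "C \<subseteq> P \<or> C \<subseteq> Q \<or> C \<subseteq> topspace Z - L"
        if "connectedin Z C" "C \<subseteq> topspace Z - {l}" for C
      proof -
        have sub: "C \<subseteq> (P \<union> Q) \<union> (topspace Z - L)" using that(2) PQL by blast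
        have "C \<subseteq> P \<union> Q \<or> C \<subseteq> topspace Z - L"
          using connectedin_open_cases[OF that(1) openin_Un[OF PQ] opN _ sub] PQL by blast
        then show ?thesis using connectedin_open_cases[OF that(1) PQ PQL(2)] by blast
      qed
      \<comment> \<open>Two connected sets, each inside one of three disjoint pieces, cannot cover
        them all: \<open>P\<close> and \<open>Q\<close> are nonempty, and \<open>z\<close> lies in
        the third.\<close>
      have "L' \<subseteq> P \<or> L' \<subseteq> Q \<or> L' \<subseteq> topspace Z - L" "M' \<subseteq> P \<or> M' \<subseteq> Q \<or> M' \<subseteq> topspace Z - L"
        using three connectedin_if_homeomorphic_real L'M' by blast+
      moreover have "P \<union> Q \<union> (topspace Z - L) = L' \<union> M'"
        using PQL L'M'(4) l openin_subset[OF L(1)] by blast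
      moreover have "z \<in> topspace Z - L" using z LM by blast
      ultimately show False using ne PQL by blast
    qed
    \<comment> \<open>The closure can add only \<open>z\<close>, and it does since \<open>L\<close>
      is not closed; so \<open>insert z L\<close> is connected as the closure of a connected
      set.\<close>
    have "Z closure_of L \<subseteq> insert z L"
      using closed by (intro closure_of_minimal) auto
    moreover have "Z closure_of L \<noteq> L" using not_closed by (metis closedin_closure_of)
    ultimately have clo: "Z closure_of L = insert z L"
      using closure_of_subset[OF openin_subset[OF L(1)]] by blast
    have conK: "connectedin Z (insert z L)"
      using conL connectedin_closure_of unfolding clo[symmetric] by blast
    \<comment> \<open>Deleting a point of \<open>M\<close> leaves \<open>insert z L\<close> intact,
      so by connectedness it lies in one of the two lines of that card.\<close>
    obtain w where w: "w \<in> M" using ray_nonempty[OF M(2)] by blast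
    then have wZ: "w \<in> topspace Z" using openin_subset[OF M(1)] by blast
    obtain x :: real where "card_at Z w homeomorphic_space top_of_set (UNIV - {x})"
      using cards[OF wZ] by blast
    then obtain L' M' where L'M': "openin Z L'" "openin Z M'" "L' \<inter> M' = {}" "L' \<union> M' = topspace Z - {w}"
      "subtopology Z L' homeomorphic_space euclideanreal"
      "subtopology Z M' homeomorphic_space euclideanreal"
      by (rule card_halves[OF t1])
    have "insert z L \<subseteq> L' \<union> M'" using L'M'(4) w LM z by blast
    then have "insert z L \<subseteq> L' \<or> insert z L \<subseteq> M'"
      using connectedin_open_cases[OF conK L'M'(1,2,3)] by blast
    then obtain N where N: "openin Z N" "subtopology Z N homeomorphic_space euclideanreal" "insert z L \<subseteq> N"
      using L'M' by blast
    have zL: "z \<notin> L" using LM by blast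
    from real_line_closed_half[OF N(1,2) L(1) conL ray_nonempty[OF L(2)] zL closed N(3)]
    show "\<exists>f f'. homeomorphic_maps (subtopology Z (insert z L)) (top_of_set {..0::real}) f f'
      \<and> f z = 0 \<and> f' 0 = z" by blast
  qed
  obtain z where z: "z \<in> topspace Z" using inf by fastforce
  obtain x :: real where "card_at Z z homeomorphic_space top_of_set (UNIV - {x})" using cards[OF z] by blast
  then obtain L M where LM: "openin Z L" "openin Z M" "L \<inter> M = {}" "L \<union> M = topspace Z - {z}"
    "subtopology Z L homeomorphic_space euclideanreal"
    "subtopology Z M homeomorphic_space euclideanreal"
    by (rule card_halves[OF t1])
  have LM_sym: "M \<inter> L = {}" "M \<union> L = topspace Z - {z}" using LM by blast+
  obtain f f' where f: "homeomorphic_maps (subtopology Z (insert z L)) (top_of_set {..0::real}) f f'"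
    "f z = 0" "f' 0 = z" using halves[OF z LM(1,5,2,6,3,4)] by blast
  obtain g g' where g: "homeomorphic_maps (subtopology Z (insert z M)) (top_of_set {..0::real}) g g'"
    "g z = 0" "g' 0 = z" using halves[OF z LM(2,6,1,5) LM_sym] by blast
  \<comment> \<open>Both rays are modelled on \<open>{..0}\<close>; reflecting the second makes the
    models meet exactly at \<open>0\<close>, the image of \<open>z\<close> under both maps.\<close>
  have "homeomorphic_maps (top_of_set {..0::real}) (top_of_set {0..}) uminus uminus"
    unfolding homeomorphic_maps_def by (auto intro!: continuous_intros)
  from homeomorphic_maps_compose[OF conjI, OF g(1) this]
  have g2: "homeomorphic_maps (subtopology Z (insert z M)) (top_of_set {0::real..}) (uminus \<circ> g) (g' \<circ> uminus)" .
  show ?thesis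
  proof (rule homeomorphic_space_paste[OF _ _ _ _ _ _ f(1) g2])
    show "closedin Z (insert z L)" "closedin Z (insert z M)"
      using closed[OF z LM(1,5,2,6,3,4)] closed[OF z LM(2,6,1,5) LM_sym] .
    show "topspace Z = insert z L \<union> insert z M" using LM(4) z by blast
    show "f v = (uminus \<circ> g) v" if "v \<in> insert z L \<inter> insert z M" for v
      using that f g LM(3) by auto
    show "f' r = (g' \<circ> uminus) r" if "r \<in> {..0} \<inter> {0..}" for r
      using that f g by auto
  qed (auto simp: closed_closedin[symmetric])
qed

theorem theorem2p2:
  fixes Z :: "'b topology"
  shows "(is_reconstruction Z (euclideanreal :: real topology) \<longrightarrow> Z homeomorphic_space (euclideanreal :: real topology))
       \<and> (is_reconstruction Z (subtopology euclideanreal \<rat>) \<longrightarrow> Z homeomorphic_space (subtopology euclideanreal (\<rat> :: real set)))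
       \<and> (is_reconstruction Z (subtopology euclideanreal (- \<rat>)) \<longrightarrow> Z homeomorphic_space (subtopology euclideanreal (- (\<rat> :: real set))))"
proof -
  obtain c :: real where "c \<notin> \<rat>" using ex_irrational by blast
  then show ?thesis
    using reconstruction_real_line dyadic_grid_gap.reconstruction_homeomorphic
      dyadic_grid_gap_Rats dyadic_grid_gap_irrationals by blast
qed

end
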